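(* There is an absolute constant $c>0$ such that for every finite set $P\subset\mathbb{R}^2$ with $|P|\ge 2$, $$|\Lambda(P)|\ \ge\ c\,|P|^{199/295},\qquad \frac{199}{295}=\frac23+\frac{7}{885}.$$
   Context: For a finite set $P\subset\mathbb{R}^2$, $\Lambda(P)=\{p\cdot q: p,q\in P\}$ is the set of dot products determined by $P$, where $p\cdot q$ is the standard inner product; self-pairs $p=q$ are included. *)

theory Defs
  imports "HOL-Analysis.Analysis"
begin

definition dot_products :: "(real^2) set \<Rightarrow> real set" where
  "dot_products P = {p \<bullet> q | p q. p \<in> P \<and> q \<in> P}"

end

theory Submission
  imports Defs
begin

text \<open>
  Write \<open>N = |P|\<close> and \<open>L = |\<Lambda>(P)|\<close>, and call a line through the origin rich if it contains at least \<open>M\<close>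
  points of \<open>P\<close>. Taking one point \<open>p\<close> on each of \<open>k\<close> lines through the origin, the \<open>k\<close> projections
  \<open>q \<mapsto> p \<bullet> q\<close> have at most \<open>L\<close> values each, and a crossing argument shows that at most
  \<open>O(L + L\<^sup>2 / k)\<close> points can have this property; so at most \<open>O(L M\<^sup>1\<^sup>/\<^sup>2 + L)\<close> points lie off the rich lines.
  Rich lines are controlled by cross ratios. If \<open>s\<close> and \<open>- 1 / m\<close> are slopes of rich lines then
  \<open>x y (m - s)\<close> lies, up to normalisation, in \<open>\<Lambda>(P)\<close> for at least \<open>M\<close> values of \<open>x\<close> and of \<open>y\<close>. Along a
  closed walk of length ten in the complete bipartite graph on the \<open>s\<close> and \<open>m\<close>, the alternating product of
  the \<open>m - s\<close> is thus represented \<open>M\<^sup>9\<close> times by tuples in \<open>\<Lambda>(P)\<^sup>1\<^sup>0\<close>. On the other hand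
  \<open>n\<close> rich lines yield \<open>\<Omega>(n\<^sup>3)\<close> such products, so \<open>n\<^sup>3 M\<^sup>9 = O(L\<^sup>1\<^sup>0)\<close>. As a line through the origin contains at
  most \<open>L\<close> points besides the origin, the choice \<open>M \<approx> L\<^bsup>20/21\<^esup>\<close> gives \<open>N = O(L\<^bsup>31/21\<^esup>)\<close>,
  and \<open>21/31 > 199/295\<close>.
\<close>

subsection \<open>Crossings and projections\<close>

lemma finite_set_strict_enumeration:
  fixes A :: "'a::linorder set"
  assumes "finite A"
  obtains e :: "nat \<Rightarrow> 'a"
    where "\<And>i j. i < j \<Longrightarrow> j < card A \<Longrightarrow> e i < e j" "\<And>i. i < card A \<Longrightarrow> e i \<in> A"
proof
  let ?e = "\<lambda>i. sorted_list_of_set A ! i"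
  show "?e i < ?e j" if "i < j" "j < card A" for i j
    using that assms by (metis sorted_list_of_set.length_sorted_key_list_of_set
        sorted_wrt_nth_less strict_sorted_list_of_set)
  show "?e i \<in> A" if "i < card A" for i
    using that assms by (metis nth_mem sorted_list_of_set.length_sorted_key_list_of_set
        sorted_list_of_set.set_sorted_key_list_of_set)
qed

text \<open>The crossings of the bipartite graph \<open>E\<close> drawn with its two vertex classes
  on parallel lines. Each crossing is listed once, and edges with a common end do not cross.\<close>

definition inversions :: "('a::linorder \<times> 'b::linorder) set \<Rightarrow> (('a \<times> 'b) \<times> ('a \<times> 'b)) set" where
  "inversions E = {(e, f). e \<in> E \<and> f \<in> E \<and> fst e < fst f \<and> snd f < snd e}"

lemma finite_inversions: "finite E \<Longrightarrow> finite (inversions E)"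
  by (rule finite_subset[of _ "E \<times> E"]) (auto simp: inversions_def)

text \<open>Discard the highest edge at each left vertex, then among the rest the last edge at each
  right vertex: at most \<open>card A + card B\<close> edges. A surviving edge has a higher edge
  \<open>h\<close> at its left end and a later edge \<open>f\<close> at its right end; these cross,
  and the crossing determines the surviving edge.\<close>

lemma card_le_inversions:
  assumes fin: "finite A" "finite B" and E: "E \<subseteq> A \<times> B"
  shows "card E \<le> card A + card B + card (inversions E)"
proof -
  have finE: "finite E" using fin E by (meson finite_SigmaI finite_subset)
  define R where "R = {e \<in> E. \<exists>f\<in>E. fst f = fst e \<and> snd e < snd f}"
  define Z where "Z = {e \<in> R. \<exists>f\<in>R. snd f = snd e \<and> fst e < fst f}"
  have sub: "Z \<subseteq> R" "R \<subseteq> E" by (auto simp: R_def Z_def)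
  have finR: "finite R" using finE sub finite_subset by blast
  have "inj_on fst (E - R)"
  proof (rule inj_onI)
    fix e f assume *: "e \<in> E - R" "f \<in> E - R" "fst e = fst f"
    then have "\<not> snd e < snd f" "\<not> snd f < snd e" unfolding R_def by auto
    with * show "e = f" by (simp add: prod_eq_iff)
  qed
  moreover have "fst ` (E - R) \<subseteq> A" using E by auto
  ultimately have 1: "card (E - R) \<le> card A" using fin(1) card_inj_on_le by blast
  have "inj_on snd (R - Z)"
  proof (rule inj_onI)
    fix e f assume *: "e \<in> R - Z" "f \<in> R - Z" "snd e = snd f"
    then have "\<not> fst e < fst f" "\<not> fst f < fst e" unfolding Z_def by auto
    with * show "e = f" by (simp add: prod_eq_iff)
  qed
  moreover have "snd ` (R - Z) \<subseteq> B" using E sub by auto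
  ultimately have 2: "card (R - Z) \<le> card B" using fin(2) card_inj_on_le by blast
  have "\<forall>e\<in>Z. \<exists>g. g \<in> inversions E \<and> fst (fst g) = fst e \<and> snd (snd g) = snd e"
  proof
    fix e assume "e \<in> Z"
    then obtain f where f: "f \<in> R" "snd f = snd e" "fst e < fst f" and "e \<in> R"
      by (auto simp: Z_def)
    then obtain h where "h \<in> E" "fst h = fst e" "snd e < snd h" by (auto simp: R_def)
    with f sub have "(h, f) \<in> inversions E" by (auto simp: inversions_def)
    with f \<open>fst h = fst e\<close> show "\<exists>g. g \<in> inversions E \<and> fst (fst g) = fst e \<and> snd (snd g) = snd e"
      by (metis fst_conv snd_conv)
  qed
  then obtain \<phi> where \<phi>: "\<And>e. e \<in> Z \<Longrightarrow> \<phi> e \<in> inversions E"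
      "\<And>e. e \<in> Z \<Longrightarrow> fst (fst (\<phi> e)) = fst e" "\<And>e. e \<in> Z \<Longrightarrow> snd (snd (\<phi> e)) = snd e"
    by metis
  have "inj_on \<phi> Z" by (rule inj_onI) (metis \<phi>(2,3) prod_eq_iff)
  then have 3: "card Z \<le> card (inversions E)"
    using \<phi>(1) finite_inversions[OF finE] by (intro card_inj_on_le[of \<phi>]) auto
  have "card E = card (E - R) + card R" "card R = card (R - Z) + card Z"
    using sub finE finR by (simp_all add: card_Diff_subset finite_subset card_mono)
  with 1 2 3 show ?thesis by linarith
qed

text \<open>Expanding the product of \<open>p + g x\<close> over \<open>A\<close>, with
  \<open>g\<close> zero on \<open>F\<close> and \<open>1 - p\<close> elsewhere, kills every subset
  that does not contain \<open>F\<close>. The sum is the probability that a random subset contains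
  \<open>F\<close>.\<close>

lemma sum_Pow_binomial_weight:
  fixes p :: real
  assumes "finite A" "F \<subseteq> A"
  shows "(\<Sum>S\<in>Pow A. p ^ card S * (1 - p) ^ card (A - S) * of_bool (F \<subseteq> S)) = p ^ card F"
proof -
  define g where "g x = (if x \<in> F then 0 else 1 - p)" for x
  have finF: "finite F" using assms finite_subset by blast
  have "(\<Prod>x\<in>A. p + g x) = (\<Sum>S\<in>Pow A. (\<Prod>x\<in>S. p) * (\<Prod>x\<in>A - S. g x))"
    by (rule prod_add[OF assms(1)])
  moreover have "(\<Prod>x\<in>A. p + g x) = p ^ card F"
  proof -
    have "(\<Prod>x\<in>A. p + g x) = (\<Prod>x\<in>A. if x \<in> F then p else 1)"
      by (rule prod.cong) (auto simp: g_def)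
    also have "\<dots> = (\<Prod>x\<in>F. p)"
      using assms by (simp add: prod.If_cases Int_absorb1)
    finally show ?thesis by simp
  qed
  moreover have "(\<Prod>x\<in>S. p) * (\<Prod>x\<in>A - S. g x)
      = p ^ card S * (1 - p) ^ card (A - S) * of_bool (F \<subseteq> S)" if "S \<in> Pow A" for S
  proof (cases "F \<subseteq> S")
    case True
    then have "(\<Prod>x\<in>A - S. g x) = (\<Prod>x\<in>A - S. 1 - p)"
      by (intro prod.cong) (auto simp: g_def)
    with True show ?thesis by simp
  next
    case False
    then obtain x where "x \<in> F" "x \<notin> S" by auto
    with assms have "(\<Prod>x\<in>A - S. g x) = 0"
      by (intro prod_zero) (auto simp: g_def)
    with False show ?thesis by simp
  qed
  ultimately show ?thesis by (metis (no_types, lifting) sum.cong)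
qed

text \<open>Apply \<open>card_le_inversions\<close> to random subsets of \<open>A\<close> and \<open>B\<close> that keep each element with
  probability \<open>p\<close>: an inversion involves two elements of either side, hence the factor \<open>p\<^sup>4\<close>.\<close>

lemma inversions_sampled:
  fixes p :: real and A :: "'a::linorder set" and B :: "'b::linorder set"
  assumes fin: "finite A" "finite B" and E: "E \<subseteq> A \<times> B" and p: "0 \<le> p" "p \<le> 1"
  shows "p^2 * card E \<le> p * card A + p * card B + p^4 * card (inversions E)"
proof -
  have finE: "finite E" using fin E by (meson finite_SigmaI finite_subset)
  define u where "u S = p ^ card S * (1 - p) ^ card (A - S)" for S
  define v where "v T = p ^ card T * (1 - p) ^ card (B - T)" for T
  \<comment> \<open>\<open>\<Sigma> h\<close> is the expected value of \<open>h\<close> at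
    independent random subsets \<open>S\<close> and \<open>T\<close>.\<close>
  define \<Sigma> where "\<Sigma> h = (\<Sum>S\<in>Pow A. \<Sum>T\<in>Pow B. u S * v T * h S T)" for h :: "'a set \<Rightarrow> 'b set \<Rightarrow> real"
  have nonneg: "0 \<le> u S * v T" for S T using p by (simp add: u_def v_def)
  have mono: "\<Sigma> h \<le> \<Sigma> k" if "\<And>S T. S \<subseteq> A \<Longrightarrow> T \<subseteq> B \<Longrightarrow> h S T \<le> k S T" for h k
    unfolding \<Sigma>_def using that nonneg by (intro sum_mono mult_left_mono) auto
  have add: "\<Sigma> (\<lambda>S T. h S T + k S T) = \<Sigma> h + \<Sigma> k" for h k
    by (simp add: \<Sigma>_def distrib_left sum.distrib)
  have swap: "\<Sigma> (\<lambda>S T. \<Sum>x\<in>X. h x S T) = (\<Sum>x\<in>X. \<Sigma> (h x))" for X :: "'z set" and h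
  proof -
    have "\<Sigma> (\<lambda>S T. \<Sum>x\<in>X. h x S T) = (\<Sum>S\<in>Pow A. \<Sum>T\<in>Pow B. \<Sum>x\<in>X. u S * v T * h x S T)"
      by (simp add: \<Sigma>_def sum_distrib_left)
    also have "\<dots> = (\<Sum>S\<in>Pow A. \<Sum>x\<in>X. \<Sum>T\<in>Pow B. u S * v T * h x S T)"
      by (intro sum.cong refl sum.swap)
    also have "\<dots> = (\<Sum>x\<in>X. \<Sum>S\<in>Pow A. \<Sum>T\<in>Pow B. u S * v T * h x S T)"
      by (rule sum.swap)
    finally show ?thesis by (simp add: \<Sigma>_def)
  qed
  have prob: "\<Sigma> (\<lambda>S T. of_bool (F \<subseteq> S) * of_bool (G \<subseteq> T)) = p ^ card F * p ^ card G"
    if "F \<subseteq> A" "G \<subseteq> B" for F G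
  proof -
    have "\<Sigma> (\<lambda>S T. of_bool (F \<subseteq> S) * of_bool (G \<subseteq> T))
        = (\<Sum>S\<in>Pow A. u S * of_bool (F \<subseteq> S)) * (\<Sum>T\<in>Pow B. v T * of_bool (G \<subseteq> T))"
      unfolding \<Sigma>_def sum_product by (intro sum.cong refl) (simp add: mult_ac)
    then show ?thesis
      using sum_Pow_binomial_weight[OF fin(1) that(1)] sum_Pow_binomial_weight[OF fin(2) that(2)]
      by (simp add: u_def v_def)
  qed
  have "p^2 * card E = \<Sigma> (\<lambda>S T. \<Sum>e\<in>E. of_bool ({fst e} \<subseteq> S) * of_bool ({snd e} \<subseteq> T))"
  proof -
    have "\<Sigma> (\<lambda>S T. \<Sum>e\<in>E. of_bool ({fst e} \<subseteq> S) * of_bool ({snd e} \<subseteq> T)) = (\<Sum>e\<in>E. p^2)"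
      unfolding swap using E by (intro sum.cong refl, subst prob) (auto simp: power2_eq_square)
    then show ?thesis by simp
  qed
  also have "\<dots> = \<Sigma> (\<lambda>S T. real (card (E \<inter> S \<times> T)))"
  proof -
    have "(\<Sum>e\<in>E. of_bool ({fst e} \<subseteq> S) * of_bool ({snd e} \<subseteq> T)) = real (card (E \<inter> S \<times> T))" for S T
    proof -
      have "(\<Sum>e\<in>E. of_bool ({fst e} \<subseteq> S) * of_bool ({snd e} \<subseteq> T))
          = (\<Sum>e\<in>E. if e \<in> S \<times> T then 1 else (0::real))"
        by (intro sum.cong refl) (auto simp: mem_Times_iff)
      then show ?thesis by (simp add: sum.inter_restrict[OF finE, symmetric])
    qed
    then show ?thesis by simp
  qed
  also have "\<dots> \<le> \<Sigma> (\<lambda>S T. real (card S) + real (card T) + real (card (inversions (E \<inter> S \<times> T))))"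
  proof (rule mono)
    fix S T assume "S \<subseteq> A" "T \<subseteq> B"
    then have "finite S" "finite T" using fin finite_subset by auto
    from card_le_inversions[OF this, of "E \<inter> S \<times> T"]
    show "real (card (E \<inter> S \<times> T))
        \<le> real (card S) + real (card T) + real (card (inversions (E \<inter> S \<times> T)))" by simp
  qed
  also have "\<dots> = \<Sigma> (\<lambda>S T. real (card S)) + \<Sigma> (\<lambda>S T. real (card T))
      + \<Sigma> (\<lambda>S T. real (card (inversions (E \<inter> S \<times> T))))"
    by (simp add: add)
  also have "\<Sigma> (\<lambda>S T. real (card S)) = p * card A"
  proof -
    have "\<Sigma> (\<lambda>S T. real (card S)) = \<Sigma> (\<lambda>S T. \<Sum>a\<in>A. of_bool ({a} \<subseteq> S) * of_bool ({} \<subseteq> T))"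
      unfolding \<Sigma>_def using fin
      by (intro sum.cong refl) (auto simp: Int_absorb1 of_bool_def sum.If_cases)
    also have "\<dots> = (\<Sum>a\<in>A. p)"
      unfolding swap by (intro sum.cong refl, subst prob) auto
    finally show ?thesis by simp
  qed
  also have "\<Sigma> (\<lambda>S T. real (card T)) = p * card B"
  proof -
    have "\<Sigma> (\<lambda>S T. real (card T)) = \<Sigma> (\<lambda>S T. \<Sum>b\<in>B. of_bool ({} \<subseteq> S) * of_bool ({b} \<subseteq> T))"
      unfolding \<Sigma>_def using fin
      by (intro sum.cong refl) (auto simp: Int_absorb1 of_bool_def sum.If_cases)
    also have "\<dots> = (\<Sum>b\<in>B. p)"
      unfolding swap by (intro sum.cong refl, subst prob) auto
    finally show ?thesis by simp
  qed
  also have "\<Sigma> (\<lambda>S T. real (card (inversions (E \<inter> S \<times> T)))) = p^4 * card (inversions E)"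
  proof -
    have "real (card (inversions (E \<inter> S \<times> T)))
        = (\<Sum>g\<in>inversions E. of_bool ({fst (fst g), fst (snd g)} \<subseteq> S) * of_bool ({snd (fst g), snd (snd g)} \<subseteq> T))"
      for S T
    proof -
      have "(\<Sum>g\<in>inversions E. of_bool ({fst (fst g), fst (snd g)} \<subseteq> S) * of_bool ({snd (fst g), snd (snd g)} \<subseteq> T))
          = (\<Sum>g\<in>inversions E. if g \<in> (S \<times> T) \<times> (S \<times> T) then 1 else (0::real))"
        by (intro sum.cong refl) (auto simp: mem_Times_iff)
      also have "\<dots> = real (card (inversions E \<inter> (S \<times> T) \<times> (S \<times> T)))"
        by (simp add: sum.inter_restrict[OF finite_inversions[OF finE], symmetric])
      also have "inversions E \<inter> (S \<times> T) \<times> (S \<times> T) = inversions (E \<inter> S \<times> T)"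
        by (auto simp: inversions_def)
      finally show ?thesis by simp
    qed
    then have "\<Sigma> (\<lambda>S T. real (card (inversions (E \<inter> S \<times> T))))
       = (\<Sum>g\<in>inversions E. \<Sigma> (\<lambda>S T. of_bool ({fst (fst g), fst (snd g)} \<subseteq> S) * of_bool ({snd (fst g), snd (snd g)} \<subseteq> T)))"
      by (simp only: swap)
    also have "\<dots> = (\<Sum>g\<in>inversions E. p^4)"
    proof (intro sum.cong refl)
      fix g assume "g \<in> inversions E"
      then have "fst (fst g) \<noteq> fst (snd g)" "snd (fst g) \<noteq> snd (snd g)" "fst g \<in> E" "snd g \<in> E"
        by (auto simp: inversions_def)
      with E show "\<Sigma> (\<lambda>S T. of_bool ({fst (fst g), fst (snd g)} \<subseteq> S) * of_bool ({snd (fst g), snd (snd g)} \<subseteq> T)) = p^4"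
        by (subst prob) (auto simp: card_insert_if eval_nat_numeral)
    qed
    finally show ?thesis by simp
  qed
  finally show ?thesis by simp
qed

text \<open>Sampling with probability \<open>4 * L / card E\<close> makes the vertex terms
  \<open>2 * p * L\<close> half of \<open>p^2 * card E\<close>, so the crossing term must supply the
  other half.\<close>

lemma crossing_lemma:
  assumes "finite A" "finite B" "E \<subseteq> A \<times> B" "card A \<le> L" "card B \<le> L" "4 * L \<le> card E" "0 < L"
  shows "real (card E)^3 \<le> 32 * real L^2 * card (inversions E)"
proof -
  define p where "p = 4 * real L / card E"
  have pos: "0 < real (card E)" "0 < real L" using assms by auto
  have "real (4 * L) \<le> real (card E)" using assms(6) by (rule of_nat_mono)
  then have p: "0 < p" "p \<le> 1" using pos by (auto simp: p_def field_simps)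
  have "p^2 * card E \<le> p * card A + p * card B + p^4 * card (inversions E)"
    using inversions_sampled[OF assms(1-3), of p] p by simp
  also have "\<dots> \<le> p * L + p * L + p^4 * card (inversions E)"
    using assms p by (intro add_mono mult_left_mono) auto
  finally have "p^2 * card E \<le> 2 * p * L + p^4 * card (inversions E)" by simp
  moreover have "p * card E = 4 * L" using pos by (simp add: p_def)
  then have "p^2 * card E = 4 * p * L" by (simp add: power2_eq_square mult_ac)
  ultimately have "2 * p * L \<le> p^4 * card (inversions E)" by linarith
  then have "p * (2 * real L) \<le> p * (p^3 * card (inversions E))"
    by (simp add: power3_eq_cube power4_eq_xxxx mult_ac)
  then have "2 * real L \<le> p^3 * card (inversions E)" using p(1) by (rule mult_left_le_imp_le)
  then have "2 * real L * card E^3 \<le> (p * card E)^3 * card (inversions E)"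
    using mult_right_mono[of "2 * real L" "p^3 * card (inversions E)" "card E^3"]
    by (simp add: power_mult_distrib mult_ac)
  also have "\<dots> = 64 * real L^3 * card (inversions E)"
    using \<open>p * card E = 4 * L\<close> by (simp add: power_mult_distrib)
  finally have "(2 * real L) * real (card E)^3 \<le> (2 * real L) * (32 * real L^2 * card (inversions E))"
    by (simp add: eval_nat_numeral mult_ac)
  then show ?thesis using pos by (simp add: mult_ac)
qed

text \<open>A linear function changes sign only once, so a pair of points is inverted between at most one pair
  of consecutive projections, whereas the crossing lemma forces many inversions between any such pair.\<close>

lemma few_projections:
  fixes Q :: "(real \<times> real) set" and T :: "real set"
  assumes "finite Q" "finite T" and proj: "\<And>t. t \<in> T \<Longrightarrow> card ((\<lambda>q. fst q + snd q * t) ` Q) \<le> L"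
    and "4 * L \<le> card Q" "0 < L"
  shows "(real (card T) - 1) * card Q \<le> 32 * real L^2"
proof -
  obtain t where t: "\<And>i j. i < j \<Longrightarrow> j < card T \<Longrightarrow> t i < t j" "\<And>i. i < card T \<Longrightarrow> t i \<in> T"
    using finite_set_strict_enumeration[OF assms(2)] by blast
  define f where "f i q = fst q + snd q * t i" for i and q :: "real \<times> real"
  define n where "n = card T - 1"
  define C where "C i = {(q, r) \<in> Q \<times> Q. f i q < f i r \<and> f (Suc i) r < f (Suc i) q}" for i
  have C_ge: "real (card Q)^3 \<le> 32 * real L^2 * card (C i)" if "i < n" for i
  proof -
    from that have i: "Suc i < card T" "i < card T" by (auto simp: n_def)
    \<comment> \<open>Two different projections determine a point, so \<open>Q\<close> becomes a
      bipartite graph with \<open>card Q\<close> edges between two sets of at most \<open>L\<close>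
      values; \<open>C i\<close> corresponds to its crossings.\<close>
    let ?h = "\<lambda>q. (f i q, f (Suc i) q)"
    have "inj_on ?h Q"
    proof (rule inj_onI)
      fix q r assume "?h q = ?h r"
      then have 1: "fst q + snd q * t i = fst r + snd r * t i"
        and "fst q + snd q * t (Suc i) = fst r + snd r * t (Suc i)" by (auto simp: f_def)
      then have "(snd q - snd r) * (t (Suc i) - t i) = 0" by (simp add: algebra_simps)
      moreover have "t (Suc i) \<noteq> t i" using t(1)[of i "Suc i"] i by auto
      ultimately have "snd q = snd r" by simp
      with 1 show "q = r" by (simp add: prod_eq_iff)
    qed
    then have "card (?h ` Q) = card Q" and inj: "inj_on (map_prod ?h ?h) (Q \<times> Q)"
      by (auto simp: card_image map_prod_inj_on)
    have "inversions (?h ` Q) = map_prod ?h ?h ` C i"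
      by (force simp: inversions_def C_def)
    moreover have "card (map_prod ?h ?h ` C i) = card (C i)"
      by (rule card_image, rule inj_on_subset[OF inj]) (auto simp: C_def)
    moreover have "real (card (?h ` Q))^3 \<le> 32 * real L^2 * card (inversions (?h ` Q))"
      using assms proj[OF t(2)[OF i(1)]] proj[OF t(2)[OF i(2)]] \<open>card (?h ` Q) = card Q\<close>
      by (intro crossing_lemma[of "f i ` Q" "f (Suc i) ` Q"]) (auto simp: f_def[abs_def])
    ultimately show ?thesis using \<open>card (?h ` Q) = card Q\<close> by simp
  qed
  \<comment> \<open>A common pair would give an affine function positive at \<open>t i\<close>,
    negative at \<open>t (Suc i)\<close> and positive again at \<open>t j\<close>.\<close>
  have disj: "C i \<inter> C j = {}" if "i < j" "j < n" for i j
  proof -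
    have False if "(q, r) \<in> C i" "(q, r) \<in> C j" for q r
    proof -
      define a b where "a = fst r - fst q" and "b = snd r - snd q"
      have "0 < a + b * t i" "a + b * t (Suc i) < 0" "0 < a + b * t j"
        using that by (auto simp: C_def f_def a_def b_def algebra_simps)
      moreover have "t i < t (Suc i)"
        using t(1)[of i "Suc i"] \<open>i < j\<close> \<open>j < n\<close> by (simp add: n_def)
      moreover have "t (Suc i) \<le> t j"
        using t(1)[of "Suc i" j] \<open>i < j\<close> \<open>j < n\<close>
        by (cases "Suc i = j") (simp_all add: n_def less_imp_le)
      moreover from calculation have "b * (t (Suc i) - t i) < 0" "0 < b * (t j - t (Suc i))"
        by (auto simp: algebra_simps)
      ultimately show False by (auto simp: mult_less_0_iff zero_less_mult_iff)
    qed
    then show ?thesis by auto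
  qed
  have disj': "\<forall>i\<in>{..<n}. \<forall>j\<in>{..<n}. i \<noteq> j \<longrightarrow> C i \<inter> C j = {}"
    using disj by (metis inf_commute lessThan_iff linorder_neqE_nat)
  have finC: "finite (C i)" for i
    by (rule finite_subset[of _ "Q \<times> Q"]) (use assms(1) in \<open>auto simp: C_def\<close>)
  have "(\<Sum>i<n. card (C i)) = card (\<Union>i<n. C i)"
    using finC disj' by (intro card_UN_disjoint[symmetric]) auto
  also have "\<dots> \<le> card (Q \<times> Q)"
    using assms(1) by (intro card_mono) (auto simp: C_def)
  finally have "(\<Sum>i<n. card (C i)) \<le> card Q * card Q" by (simp add: card_cartesian_product)
  then have sum: "(\<Sum>i<n. real (card (C i))) \<le> real (card Q)^2"
    by (simp add: power2_eq_square flip: of_nat_sum of_nat_mult)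
  have "n * real (card Q)^3 \<le> (\<Sum>i<n. 32 * real L^2 * card (C i))"
    using sum_mono[of "{..<n}" "\<lambda>_. real (card Q)^3"] C_ge by simp
  also have "\<dots> \<le> 32 * real L^2 * real (card Q)^2"
    using sum by (simp add: sum_distrib_left[symmetric] mult_left_mono)
  finally have "real (card Q)^2 * (n * card Q) \<le> real (card Q)^2 * (32 * real L^2)"
    by (simp add: eval_nat_numeral mult_ac)
  moreover have "0 < card Q" using assms by linarith
  ultimately have "n * real (card Q) \<le> 32 * real L^2" by simp
  moreover have "real (card T) - 1 \<le> n" by (simp add: n_def)
  ultimately show ?thesis
    by (smt (verit) mult_right_mono of_nat_0_le_iff)
qed

subsection \<open>Growth of alternating products of cross ratios\<close>

text \<open>For \<open>s < s' < m < m'\<close> its logarithm is the measure of the rectangle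
  \<open>[s, s'] \<times> [m, m']\<close> with density \<open>1 / (v - u)^2\<close> at
  \<open>(u, v)\<close>.\<close>

definition cross_ratio :: "real \<Rightarrow> real \<Rightarrow> real \<Rightarrow> real \<Rightarrow> real" where
  "cross_ratio s s' m m' = (m' - s') * (m - s) / ((m - s') * (m' - s))"

text \<open>Equality of the two cross ratios at \<open>(x, y)\<close> means \<open>\<psi> x = \<psi> y\<close> for a function \<open>\<psi>\<close> whose
  critical points \<open>z > q'\<close> satisfy \<open>A z * B z = const\<close> with \<open>A\<close> and \<open>B\<close> increasing; so there is only one, and
  Rolle's theorem places one in each of the two intervals.\<close>

lemma cross_ratio_eq_unique:
  assumes "p < q" "q \<le> p'" "p' < q'" "q' < x" "x < y" "y \<le> x'" "x' < y'"
    and eq: "cross_ratio p q x y = cross_ratio p' q' x y"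
            "cross_ratio p q x' y' = cross_ratio p' q' x' y'"
  shows False
proof -
  \<comment> \<open>Chosen so that \<open>\<psi> y - \<psi> x\<close> is the logarithm of the
    quotient of the two cross ratios at \<open>(x, y)\<close>.\<close>
  define \<psi> where "\<psi> z = ln (z - q) - ln (z - p) - ln (z - q') + ln (z - p')" for z
  have ln_cr: "ln (cross_ratio s s' m m') = (ln (m' - s') - ln (m' - s)) - (ln (m - s') - ln (m - s))"
    if "s < s'" "s' < m" "m < m'" for s s' m m'
    using that by (simp add: cross_ratio_def ln_mult ln_div)
  have crit: "\<exists>z. a < z \<and> z < b \<and> (z - p) * (z - q) * (q' - p') = (z - p') * (z - q') * (q - p)"
    if "q' < a" "a < b" and e: "cross_ratio p q a b = cross_ratio p' q' a b" for a b
  proof -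
    have "\<psi> a = \<psi> b"
      using arg_cong[OF e, of ln] ln_cr[of p q a b] ln_cr[of p' q' a b] that assms
      by (simp add: \<psi>_def)
    moreover have deriv: "(\<psi> has_real_derivative
        (1 / (z - q) - 1 / (z - p) - 1 / (z - q') + 1 / (z - p'))) (at z)" if "a \<le> z" for z
      unfolding \<psi>_def using that assms \<open>q' < a\<close>
      by (auto intro!: derivative_eq_intros)
    ultimately obtain z where z: "a < z" "z < b"
        "1 / (z - q) - 1 / (z - p) - 1 / (z - q') + 1 / (z - p') = 0"
    proof -
      have "continuous_on {a..b} \<psi>"
        using deriv by (intro DERIV_continuous_on) (auto intro: has_field_derivative_at_within)
      moreover have "\<And>z. a < z \<Longrightarrow> z < b \<Longrightarrow> \<exists>D. (\<psi> has_real_derivative D) (at z)"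
        using deriv by (meson less_imp_le)
      ultimately obtain z where "a < z" "z < b" "(\<psi> has_real_derivative 0) (at z)"
        using Rolle[OF \<open>a < b\<close> \<open>\<psi> a = \<psi> b\<close>] real_differentiable_def by metis
      with that deriv[of z] show ?thesis using DERIV_unique less_imp_le by metis
    qed
    have pos: "z - q \<noteq> 0" "z - p \<noteq> 0" "z - q' \<noteq> 0" "z - p' \<noteq> 0"
      using assms \<open>q' < a\<close> z by auto
    have "1 / (z - q) - 1 / (z - p) = (q - p) / ((z - p) * (z - q))"
      "1 / (z - q') - 1 / (z - p') = (q' - p') / ((z - p') * (z - q'))"
      using pos by (simp_all add: field_simps)
    with z(3) have "(q - p) / ((z - p) * (z - q)) = (q' - p') / ((z - p') * (z - q'))" by simp
    then have "(z - p) * (z - q) * (q' - p') = (z - p') * (z - q') * (q - p)"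
      using pos by (simp add: frac_eq_eq mult_ac)
    with z show ?thesis by blast
  qed
  obtain z where z: "x < z" "z < y" "(z - p) * (z - q) * (q' - p') = (z - p') * (z - q') * (q - p)"
    using crit[of x y] assms by auto
  obtain z' where z': "x' < z'" "z' < y'" "(z' - p) * (z' - q) * (q' - p') = (z' - p') * (z' - q') * (q - p)"
    using crit[of x' y'] assms by auto
  define A where "A z = (z - p') / (z - p)" for z
  define B where "B z = (z - q') / (z - q)" for z
  have less: "(u - b) / (u - a) < (v - b) / (v - a)" if "a < b" "b < u" "u < v" for a b u v :: real
  proof -
    have "(u - b) * (v - a) - (v - b) * (u - a) = (b - a) * (u - v)" by (simp add: algebra_simps)
    also have "\<dots> < 0" using that by (simp add: mult_less_0_iff)
    finally show ?thesis using that by (simp add: divide_less_eq less_divide_eq mult_ac)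
  qed
  have "A z < A z'" "B z < B z'" "0 < A z" "0 < B z"
    using assms z z' by (auto simp: A_def B_def intro!: less)
  then have "A z * B z < A z' * B z'" by (intro mult_strict_mono) auto
  moreover have "A z * B z = (q' - p') / (q - p)" "A z' * B z' = (q' - p') / (q - p)"
    using assms z z' by (simp_all add: A_def B_def frac_eq_eq mult_ac)
  ultimately show False by simp
qed

section \<open>Counting alternating products along closed walks of length ten\<close>

definition ten_cycles :: "real set \<Rightarrow> real set \<Rightarrow> real set" where
  "ten_cycles S T = {(m1 - s1) / (m1 - s2) * ((m2 - s2) / (m2 - s3)) * ((m3 - s3) / (m3 - s4))
      * ((m4 - s4) / (m4 - s5)) * ((m5 - s5) / (m5 - s1)) | s1 s2 s3 s4 s5 m1 m2 m3 m4 m5.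
      {s1, s2, s3, s4, s5} \<subseteq> S \<and> {m1, m2, m3, m4, m5} \<subseteq> T}"

lemma finite_ten_cycles:
  assumes "finite S" "finite T"
  shows "finite (ten_cycles S T)"
proof -
  let ?f = "\<lambda>((s1, s2, s3, s4, s5), (m1, m2, m3, m4, m5)).
      (m1 - s1) / (m1 - s2) * ((m2 - s2) / (m2 - s3)) * ((m3 - s3) / (m3 - s4))
      * ((m4 - s4) / (m4 - s5)) * ((m5 - s5) / (m5 - s1)) :: real"
  have "ten_cycles S T \<subseteq> ?f ` ((S \<times> S \<times> S \<times> S \<times> S) \<times> (T \<times> T \<times> T \<times> T \<times> T))"
  proof
    fix w assume "w \<in> ten_cycles S T"
    then obtain s1 s2 s3 s4 s5 m1 m2 m3 m4 m5 where
      "w = ?f ((s1, s2, s3, s4, s5), (m1, m2, m3, m4, m5))"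
      "{s1, s2, s3, s4, s5} \<subseteq> S" "{m1, m2, m3, m4, m5} \<subseteq> T"
      unfolding ten_cycles_def by auto
    then show "w \<in> ?f ` ((S \<times> S \<times> S \<times> S \<times> S) \<times> (T \<times> T \<times> T \<times> T \<times> T))"
      by (intro image_eqI[where x = "((s1, s2, s3, s4, s5), (m1, m2, m3, m4, m5))"]) auto
  qed
  then show ?thesis using assms by (auto intro: finite_subset)
qed

text \<open>Ordered column by column, the cells of the grid \<open>S \<times> T\<close> give an increasing chain \<open>pos j i\<close>
  (the cross-ratio measure of the columns before \<open>j\<close> and of the first \<open>i\<close> cells of column \<open>j\<close>), with steps \<open>c i j\<close>.
  Multiplying \<open>pos j i\<close> by a smaller step \<open>c i' j\<close> of the same column squeezes a new value between two
  members of the chain. By \<open>cross_ratio_eq_unique\<close> the steps in a typical column take many values.\<close>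

lemma card_ten_cycles_ge:
  assumes fin: "finite S" "finite T" and sep: "\<And>s m. s \<in> S \<Longrightarrow> m \<in> T \<Longrightarrow> s < m"
    and card: "n < card S" "n < card T" and n: "4 \<le> n"
  shows "n ^ 3 \<le> 16 * card (ten_cycles S T)"
proof -
  obtain s where s: "\<And>i j. i < j \<Longrightarrow> j < card S \<Longrightarrow> s i < s j" "\<And>i. i < card S \<Longrightarrow> s i \<in> S"
    using finite_set_strict_enumeration[OF fin(1)] by blast
  obtain m where m: "\<And>i j. i < j \<Longrightarrow> j < card T \<Longrightarrow> m i < m j" "\<And>i. i < card T \<Longrightarrow> m i \<in> T"
    using finite_set_strict_enumeration[OF fin(2)] by blast
  have sm: "s i < m j" if "i \<le> n" "j \<le> n" for i j using that card s(2) m(2) sep by simp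
  have s_less: "s i < s j" if "i < j" "j \<le> n" for i j using that card s(1) by simp
  have m_less: "m i < m j" if "i < j" "j \<le> n" for i j using that card m(1) by simp
  have s_le: "s i \<le> s j" if "i \<le> j" "j \<le> n" for i j using that s_less[of i j] by (cases "i = j") auto
  have m_le: "m i \<le> m j" if "i \<le> j" "j \<le> n" for i j using that m_less[of i j] by (cases "i = j") auto
  define c where "c i j = cross_ratio (s i) (s (Suc i)) (m j) (m (Suc j))" for i j
  \<comment> \<open>\<open>good j\<close> keeps the first row of each value in column
    \<open>j\<close>, so its size is the number of distinct steps there.\<close>
  define good where "good j = {i. i < n \<and> (\<forall>i'<i. c i' j \<noteq> c i j)}" for j
  have good_sub: "good j \<subseteq> {..<n}" for j by (auto simp: good_def)
  then have fin_good: "finite (good j)" for j using finite_subset by blast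
  have c_unique: "j = j'" if "i' < i" "i < n" "j < n" "j' < n" "c i' j = c i j" "c i' j' = c i j'" for i i' j j'
  proof -
    have False if "j < j'" "j' < n" "c i' j = c i j" "c i' j' = c i j'" for j j'
      using \<open>i' < i\<close> \<open>i < n\<close> that
      by (intro cross_ratio_eq_unique[of "s i'" "s (Suc i')" "s i" "s (Suc i)"
            "m j" "m (Suc j)" "m j'" "m (Suc j')"])
        (auto simp: c_def intro!: s_less m_less s_le m_le sm)
    from this[of j j'] this[of j' j] that show ?thesis by (metis linorder_neqE_nat)
  qed
  define bad where "bad = (SIGMA j:{..<n}. {..<n} - good j)"
  have "\<forall>x\<in>bad. \<exists>i'. i' < snd x \<and> c i' (fst x) = c (snd x) (fst x)"
    by (auto simp: bad_def good_def)
  then obtain g where g: "\<And>x. x \<in> bad \<Longrightarrow> g x < snd x" "\<And>x. x \<in> bad \<Longrightarrow> c (g x) (fst x) = c (snd x) (fst x)"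
    by metis
  \<comment> \<open>A bad cell repeats the step of an earlier row. Two rows agree in at most one
    column, so the cell is determined by this pair of rows.\<close>
  have bad_card: "2 * card bad \<le> n * n"
  proof -
    have "inj_on (\<lambda>x. (snd x, g x)) bad"
    proof (rule inj_onI)
      fix x y assume *: "x \<in> bad" "y \<in> bad" "(snd x, g x) = (snd y, g y)"
      then have "fst x = fst y"
        using c_unique[of "g x" "snd x" "fst x" "fst y"] g[of x] g[of y] by (auto simp: bad_def)
      with * show "x = y" by (simp add: prod_eq_iff)
    qed
    moreover have "(\<lambda>x. (snd x, g x)) ` bad \<subseteq> (SIGMA i:{..<n}. {..<i})"
      using g(1) by (auto simp: bad_def)
    ultimately have "card bad \<le> card (SIGMA i:{..<n}. {..<i})" by (intro card_inj_on_le) auto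
    also have "\<dots> = (\<Sum>i<n. i)" by simp
    also have "2 * \<dots> \<le> n * n"
      by (induction n) auto
    finally show ?thesis by simp
  qed
  have sum_good: "n * n \<le> 2 * (\<Sum>j<n. card (good j))"
  proof -
    have "card bad = (\<Sum>j<n. n - card (good j))"
      unfolding bad_def by (simp add: card_Diff_subset fin_good good_sub)
    moreover have "(\<Sum>j<n. n - card (good j)) + (\<Sum>j<n. card (good j)) = (\<Sum>j<n. n)"
    proof (subst sum.distrib[symmetric], rule sum.cong)
      fix j show "n - card (good j) + card (good j) = n"
        using card_mono[OF _ good_sub, of j] by simp
    qed simp
    ultimately show ?thesis using bad_card by simp
  qed
  define pos where "pos j i = cross_ratio (s 0) (s n) (m 0) (m j) * cross_ratio (s 0) (s i) (m j) (m (Suc j))" for j i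
  have cr_ge1: "1 \<le> cross_ratio a b x y" if "a \<le> b" "b < x" "x \<le> y" for a b x y
  proof -
    have "0 \<le> (b - a) * (y - x)" using that by simp
    then have "(x - b) * (y - a) \<le> (y - b) * (x - a)" by (simp add: algebra_simps)
    moreover have "0 < (x - b) * (y - a)" using that by simp
    ultimately show ?thesis by (simp add: cross_ratio_def le_divide_eq_1_pos)
  qed
  have cr_gt1: "1 < cross_ratio a b x y" if "a < b" "b < x" "x < y" for a b x y
  proof -
    have "0 < (b - a) * (y - x)" using that by simp
    then have "(x - b) * (y - a) < (y - b) * (x - a)" by (simp add: algebra_simps)
    moreover have "0 < (x - b) * (y - a)" using that by simp
    ultimately show ?thesis by (simp add: cross_ratio_def less_divide_eq_1_pos)
  qed
  \<comment> \<open>Additivity of the rectangle measure when a rectangle is cut, first in the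
    \<open>s\<close> direction and then in the \<open>m\<close> direction.\<close>
  have cr_row: "cross_ratio a b x y * cross_ratio b d x y = cross_ratio a d x y"
    if "a < x" "b < x" "d < x" "x \<le> y" for a b d x y
    using that by (simp add: cross_ratio_def frac_eq_eq mult_ac)
  have cr_col: "cross_ratio a b x y * cross_ratio a b y z = cross_ratio a b x z"
    if "a < x" "b < x" "x \<le> y" "y \<le> z" for a b x y z
    using that by (simp add: cross_ratio_def frac_eq_eq mult_ac)
  have pos_gt0: "0 < pos j i" if "j < n" "i \<le> n" for i j
    using that cr_ge1[of "s 0" "s n" "m 0" "m j"] cr_ge1[of "s 0" "s i" "m j" "m (Suc j)"] sm s_le m_le
    by (auto simp: pos_def intro!: mult_pos_pos)
  have pos_Suc: "pos j (Suc i) = pos j i * c i j" if "j < n" "i < n" for i j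
    using that cr_row[of "s 0" "m j" "s i" "s (Suc i)" "m (Suc j)"] sm m_le
    by (simp add: pos_def c_def mult.assoc)
  have pos_row: "pos j i \<le> pos j i'" if "j < n" "i \<le> i'" "i' \<le> n" for i i' j
    using that(2,3)
  proof (induction rule: dec_induct)
    case (step k)
    have "1 \<le> c k j" unfolding c_def using step that by (intro cr_ge1 s_le m_le sm) auto
    then have "pos j k \<le> pos j (Suc k)" using pos_Suc[of j k] pos_gt0[of j k] step that by simp
    with step show ?case by simp
  qed simp
  have pos_next: "pos j n \<le> pos j' 0" if "j < j'" "j' < n" for j j'
  proof -
    have "pos j n = cross_ratio (s 0) (s n) (m 0) (m (Suc j))"
      unfolding pos_def using that by (intro cr_col sm m_le) auto
    also have "\<dots> \<le> cross_ratio (s 0) (s n) (m 0) (m (Suc j)) * cross_ratio (s 0) (s n) (m (Suc j)) (m j')"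
      using cr_ge1[of "s 0" "s n" "m (Suc j)" "m j'"] cr_ge1[of "s 0" "s n" "m 0" "m (Suc j)"]
        that sm s_le m_le by simp
    also have "\<dots> = cross_ratio (s 0) (s n) (m 0) (m j')"
      using that by (intro cr_col sm m_le) auto
    also have "\<dots> = pos j' 0"
      using that sm[of 0 j'] sm[of 0 "Suc j'"] by (simp add: pos_def cross_ratio_def)
    finally show ?thesis .
  qed
  have pos_lex: "pos j (Suc i) \<le> pos j' i'" if "j < n" "j' < n" "i < n" "i' < n" "j < j' \<or> j = j' \<and> i < i'" for i j i' j'
    using that(5)
  proof
    assume "j < j'"
    have "pos j (Suc i) \<le> pos j n" using that by (intro pos_row) auto
    also have "\<dots> \<le> pos j' 0" using that \<open>j < j'\<close> by (intro pos_next)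
    also have "\<dots> \<le> pos j' i'" using that by (intro pos_row) auto
    finally show ?thesis .
  next
    assume "j = j' \<and> i < i'"
    with that show ?thesis by (auto intro: pos_row)
  qed
  define I where "I = (SIGMA j:{..<n}. {(i, i'). i \<in> good j \<and> i' \<in> good j \<and> c i' j < c i j})"
  define w where "w = (\<lambda>(j, i, i'). pos j i * c i' j)"
  have w_between: "pos j i < w (j, i, i') \<and> w (j, i, i') < pos j (Suc i)" if "(j, i, i') \<in> I" for j i i'
  proof -
    from that have *: "j < n" "i < n" "i' < n" "c i' j < c i j" by (auto simp: I_def good_def)
    then have "1 < c i' j" unfolding c_def by (intro cr_gt1 s_less m_less sm) auto
    with * show ?thesis using pos_gt0[of j i] pos_Suc[of j i] by (simp add: w_def)
  qed
  \<comment> \<open>The interval containing the value reveals the cell \<open>(j, i)\<close>;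
    dividing by \<open>pos j i\<close> leaves the step \<open>c i' j\<close>, which determines
    \<open>i'\<close> within \<open>good j\<close>.\<close>
  have "inj_on w I"
  proof (rule inj_onI)
    fix x y assume "x \<in> I" "y \<in> I" "w x = w y"
    moreover obtain j i i' k l l' where xy: "x = (j, i, i')" "y = (k, l, l')" by (metis prod_cases3)
    ultimately have *: "(j, i, i') \<in> I" "(k, l, l') \<in> I" "w (j, i, i') = w (k, l, l')" by auto
    then have b: "j < n" "i < n" "i' \<in> good j" "k < n" "l < n" "l' \<in> good k"
      by (auto simp: I_def good_def)
    have "\<not> (j < k \<or> j = k \<and> i < l)" "\<not> (k < j \<or> k = j \<and> l < i)"
      using pos_lex[of j k i l] pos_lex[of k j l i] w_between[OF *(1)] w_between[OF *(2)] *(3) b by force+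
    then have [simp]: "j = k" "i = l" by auto
    have "c i' k = c l' k" using *(3) pos_gt0[of k l] b by (simp add: w_def)
    with b have "i' = l'" unfolding good_def by (auto) (metis linorder_neqE_nat)
    then show "x = y" by (simp add: xy)
  qed
  moreover have "w ` I \<subseteq> ten_cycles S T"
  proof clarify
    fix j i i' assume "(j, i, i') \<in> I"
    then have b: "j < n" "i < n" "i' < n" by (auto simp: I_def good_def)
    \<comment> \<open>The three cross ratios contain twelve differences. \<open>m j - s 0\<close>
      occurs above and below and cancels; the other ten run along a closed walk that visits some
      \<open>m\<close> twice.\<close>
    let ?w = "(m j - s n) / (m j - s i) * ((m (Suc j) - s i) / (m (Suc j) - s i'))
        * ((m j - s i') / (m j - s (Suc i'))) * ((m (Suc j) - s (Suc i')) / (m (Suc j) - s 0))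
        * ((m 0 - s 0) / (m 0 - s n))"
    have "w (j, i, i') = ?w"
      using b sm[of 0 j] sm[of n j] sm[of i j] sm[of i' j] sm[of "Suc i'" j] sm[of 0 "Suc j"] sm[of i "Suc j"]
        sm[of i' "Suc j"] sm[of "Suc i'" "Suc j"] sm[of 0 0] sm[of n 0]
      by (simp add: w_def pos_def c_def cross_ratio_def frac_eq_eq mult_ac)
    moreover have "{s n, s i, s i', s (Suc i'), s 0} \<subseteq> S" "{m j, m (Suc j), m j, m (Suc j), m 0} \<subseteq> T"
      using b card s(2) m(2) by auto
    ultimately show "w (j, i, i') \<in> ten_cycles S T" unfolding ten_cycles_def by blast
  qed
  ultimately have "card I \<le> card (ten_cycles S T)"
    using finite_ten_cycles[OF fin] card_inj_on_le by blast
  moreover have "real n ^ 3 \<le> 16 * real (card I)"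
  proof -
    \<comment> \<open>Distinct good rows have distinct steps, so the off-diagonal pairs form two
      classes exchanged by swapping.\<close>
    have half: "2 * card {(i, i'). i \<in> good j \<and> i' \<in> good j \<and> c i' j < c i j} + card (good j)
        = card (good j) * card (good j)" for j
    proof -
      let ?U = "{(i, i'). i \<in> good j \<and> i' \<in> good j \<and> c i' j < c i j}"
      let ?V = "{(i, i'). i \<in> good j \<and> i' \<in> good j \<and> c i j < c i' j}"
      let ?D = "(\<lambda>i. (i, i)) ` good j"
      have finUV: "finite ?U" "finite ?V"
        by (rule finite_subset[of _ "good j \<times> good j"]; use fin_good in auto)+
      have "c i j \<noteq> c i' j" if "i \<in> good j" "i' \<in> good j" "i \<noteq> i'" for i i'
        using that by (auto simp: good_def) (metis linorder_neqE_nat)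
      then have "(a, b) \<in> ?U \<union> ?V \<union> ?D" if "a \<in> good j" "b \<in> good j" for a b
        using that by (cases "a = b") (fastforce simp: neq_iff)+
      then have "good j \<times> good j = ?U \<union> ?V \<union> ?D" by blast
      moreover have "card (?U \<union> ?V \<union> ?D) = card ?U + card ?V + card ?D"
      proof -
        have "?U \<inter> ?V = {}" "(?U \<union> ?V) \<inter> ?D = {}" by auto
        then show ?thesis using finUV fin_good[of j] by (simp add: card_Un_disjoint)
      qed
      moreover have "?V = prod.swap ` ?U" by force
      then have "card ?V = card ?U" by (simp add: card_image)
      moreover have "card ?D = card (good j)" by (simp add: card_image inj_on_def)
      ultimately show ?thesis by (simp add: card_cartesian_product[symmetric])
    qed
    have fin_part: "finite {(i, i'). i \<in> good j \<and> i' \<in> good j \<and> c i' j < c i j}" for j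
      by (rule finite_subset[of _ "good j \<times> good j"]) (use fin_good in auto)
    \<comment> \<open>Only the sum of the \<open>card (good j)\<close> is controlled, so their
      squares are bounded below by the tangent line at \<open>n / 2\<close>.\<close>
    have ptw: "(real n - 1) * card (good j) - real n ^ 2 / 4
        \<le> 2 * card {(i, i'). i \<in> good j \<and> i' \<in> good j \<and> c i' j < c i j}" for j
    proof -
      have "real (card (good j))^2 = 2 * card {(i, i'). i \<in> good j \<and> i' \<in> good j \<and> c i' j < c i j} + real (card (good j))"
        using arg_cong[OF half[of j], of real] by (simp add: power2_eq_square)
      moreover have "0 \<le> (real (card (good j)) - real n / 2)^2" by simp
      ultimately show ?thesis by (simp add: power2_eq_square algebra_simps)
    qed
    have "card I = (\<Sum>j<n. card {(i, i'). i \<in> good j \<and> i' \<in> good j \<and> c i' j < c i j})"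
      unfolding I_def using fin_part by (intro card_SigmaI) auto
    then have "2 * real (card I) = (\<Sum>j<n. real (2 * card {(i, i'). i \<in> good j \<and> i' \<in> good j \<and> c i' j < c i j}))"
      by (simp add: sum_distrib_left)
    also have "\<dots> \<ge> (\<Sum>j<n. (real n - 1) * card (good j) - real n ^ 2 / 4)"
      using ptw by (intro sum_mono) simp
    also have "(\<Sum>j<n. (real n - 1) * card (good j) - real n ^ 2 / 4)
        = (real n - 1) * real (\<Sum>j<n. card (good j)) - real n ^ 3 / 4"
      by (simp add: sum_subtractf sum_distrib_left power2_eq_square power3_eq_cube)
    also have "\<dots> \<ge> (real n - 1) * (real n ^ 2 / 2) - real n ^ 3 / 4"
      using n of_nat_mono[OF sum_good, where ?'a = real]
      by (intro diff_mono mult_left_mono) (auto simp: power2_eq_square)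
    finally have "real n ^ 3 / 4 - real n ^ 2 / 2 \<le> 2 * card I"
      by (simp add: power2_eq_square power3_eq_cube algebra_simps)
    \<comment> \<open>Since \<open>4 \<le> n\<close>, the term \<open>n^2 / 2\<close> costs at most
      half of \<open>n^3 / 4\<close>.\<close>
    moreover have "4 * real n ^ 2 \<le> real n * real n ^ 2" using n by (intro mult_right_mono) auto
    ultimately show ?thesis by (simp add: power2_eq_square power3_eq_cube)
  qed
  ultimately have "real (n ^ 3) \<le> real (16 * card (ten_cycles S T))" by simp
  then show ?thesis using of_nat_le_iff by blast
qed

section \<open>Representing the alternating products by dot products\<close>

lemma obtain_injections:
  fixes X :: "'i \<Rightarrow> 'a::linorder set"
  assumes "0 < M" "\<And>s. s \<in> S \<Longrightarrow> M \<le> card (X s)"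
  obtains e where "\<And>s k. s \<in> S \<Longrightarrow> k < M \<Longrightarrow> e s k \<in> X s"
    "\<And>s k l. s \<in> S \<Longrightarrow> k < M \<Longrightarrow> l < M \<Longrightarrow> e s k = e s l \<Longrightarrow> k = l"
proof -
  have "\<exists>f. (\<forall>k<M. f k \<in> X s) \<and> (\<forall>k<M. \<forall>l<M. f k = f l \<longrightarrow> k = l)" if "s \<in> S" for s
  proof -
    have card: "M \<le> card (X s)" using assms that by simp
    with \<open>0 < M\<close> have "finite (X s)" using card.infinite by fastforce
    then obtain f where f: "\<And>i j. i < j \<Longrightarrow> j < card (X s) \<Longrightarrow> f i < f j"
        "\<And>i. i < card (X s) \<Longrightarrow> f i \<in> X s"
      using finite_set_strict_enumeration by blast
    have "k = l" if "k < M" "l < M" "f k = f l" for k l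
      using f(1)[of k l] f(1)[of l k] that card by (metis less_irrefl less_le_trans linorder_neqE_nat)
    with f(2) card show ?thesis by (intro exI[of _ f]) auto
  qed
  then obtain e where "\<forall>s\<in>S. (\<forall>k<M. e s k \<in> X s) \<and> (\<forall>k<M. \<forall>l<M. e s k = e s l \<longrightarrow> k = l)"
    by metis
  then show ?thesis by (intro that[of e]) auto
qed

text \<open>For a closed walk \<open>s1, m1, s2, m2, \<dots>, m5, s1\<close> one of the ten scalars attached to the vertices
  is kept fixed (there is a scaling freedom); the other nine can be read off successively from the ten elements
  of \<open>\<Lambda>\<close> on the edges.\<close>

lemma card_ten_cycles_mult_le:
  fixes X Y :: "real \<Rightarrow> real set"
  assumes fin: "finite \<Lambda>" and sep: "\<And>s m. s \<in> S \<Longrightarrow> m \<in> T \<Longrightarrow> s < m"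
    and X: "\<And>s. s \<in> S \<Longrightarrow> M \<le> card (X s)" "\<And>s. s \<in> S \<Longrightarrow> 0 \<notin> X s"
    and Y: "\<And>m. m \<in> T \<Longrightarrow> M \<le> card (Y m)" "\<And>m. m \<in> T \<Longrightarrow> 0 \<notin> Y m"
    and \<Lambda>: "\<And>s m x y. s \<in> S \<Longrightarrow> m \<in> T \<Longrightarrow> x \<in> X s \<Longrightarrow> y \<in> Y m \<Longrightarrow> x * y * (m - s) \<in> \<Lambda>"
  shows "card (ten_cycles S T) * M ^ 9 \<le> card \<Lambda> ^ 10"
proof (cases "M = 0")
  case False
  then have M: "0 < M" by simp
  obtain e where e: "\<And>s k. s \<in> S \<Longrightarrow> k < M \<Longrightarrow> e s k \<in> X s"
      "\<And>s k l. s \<in> S \<Longrightarrow> k < M \<Longrightarrow> l < M \<Longrightarrow> e s k = e s l \<Longrightarrow> k = l"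
    by (rule obtain_injections[of M S X]) (use M X in auto)
  obtain d where d: "\<And>s k. s \<in> T \<Longrightarrow> k < M \<Longrightarrow> d s k \<in> Y s"
      "\<And>s k l. s \<in> T \<Longrightarrow> k < M \<Longrightarrow> l < M \<Longrightarrow> d s k = d s l \<Longrightarrow> k = l"
    by (rule obtain_injections[of M T Y]) (use M Y in auto)
  have e0: "e s k \<noteq> 0" if "s \<in> S" "k < M" for s k using e(1)[OF that] X(2)[OF that(1)] by auto
  have d0: "d s k \<noteq> 0" if "s \<in> T" "k < M" for s k using d(1)[OF that] Y(2)[OF that(1)] by auto
  have ms: "m - s \<noteq> 0" if "s \<in> S" "m \<in> T" for s m using sep[OF that] by simp
  have peel_e: "k = l" if "e s k * y * (m - s) = e s l * y * (m - s)" "s \<in> S" "m \<in> T" "k < M" "l < M" "y \<noteq> 0"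
    for s k l y m using that ms e(2) by auto
  have peel_d: "k = l" if "x * d m k * (m - s) = x * d m l * (m - s)" "s \<in> S" "m \<in> T" "k < M" "l < M" "x \<noteq> 0"
    for s k l x m using that ms d(2) by auto
  have "\<forall>w\<in>ten_cycles S T. \<exists>s1 s2 s3 s4 s5 m1 m2 m3 m4 m5.
      w = (m1 - s1) / (m1 - s2) * ((m2 - s2) / (m2 - s3)) * ((m3 - s3) / (m3 - s4))
        * ((m4 - s4) / (m4 - s5)) * ((m5 - s5) / (m5 - s1)) \<and>
      {s1, s2, s3, s4, s5} \<subseteq> S \<and> {m1, m2, m3, m4, m5} \<subseteq> T"
    unfolding ten_cycles_def by blast
  then obtain s1 s2 s3 s4 s5 m1 m2 m3 m4 m5 where
    w_eq: "\<And>w. w \<in> ten_cycles S T \<Longrightarrow>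
      w = (m1 w - s1 w) / (m1 w - s2 w) * ((m2 w - s2 w) / (m2 w - s3 w)) * ((m3 w - s3 w) / (m3 w - s4 w))
        * ((m4 w - s4 w) / (m4 w - s5 w)) * ((m5 w - s5 w) / (m5 w - s1 w))"
    and mem: "\<And>w. w \<in> ten_cycles S T \<Longrightarrow> s1 w \<in> S \<and> s2 w \<in> S \<and> s3 w \<in> S \<and> s4 w \<in> S \<and> s5 w \<in> S \<and>
      m1 w \<in> T \<and> m2 w \<in> T \<and> m3 w \<in> T \<and> m4 w \<in> T \<and> m5 w \<in> T"
    by (simp only: bchoice_iff insert_subset) blast
  \<comment> \<open>One entry for each edge of the walk. The scalar at \<open>s1\<close> always has
    index 0; the other nine indices are free.\<close>
  define F where "F = (\<lambda>(w, a2, a3, a4, a5, b1, b2, b3, b4, b5).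
     (e (s1 w) 0 * d (m1 w) b1 * (m1 w - s1 w), e (s2 w) a2 * d (m1 w) b1 * (m1 w - s2 w),
      e (s2 w) a2 * d (m2 w) b2 * (m2 w - s2 w), e (s3 w) a3 * d (m2 w) b2 * (m2 w - s3 w),
      e (s3 w) a3 * d (m3 w) b3 * (m3 w - s3 w), e (s4 w) a4 * d (m3 w) b3 * (m3 w - s4 w),
      e (s4 w) a4 * d (m4 w) b4 * (m4 w - s4 w), e (s5 w) a5 * d (m4 w) b4 * (m4 w - s5 w),
      e (s5 w) a5 * d (m5 w) b5 * (m5 w - s5 w), e (s1 w) 0 * d (m5 w) b5 * (m5 w - s1 w)))"
  define K where "K = {..<M}"
  define W where "W = ten_cycles S T \<times> K \<times> K \<times> K \<times> K \<times> K \<times> K \<times> K \<times> K \<times> K"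
  \<comment> \<open>In this alternating quotient of the entries every scalar occurs once above and
    once below, so only \<open>w\<close> remains.\<close>
  define G where "G = (\<lambda>(x1, y1, x2, y2, x3, y3, x4, y4, x5, y5).
      x1 / y1 * (x2 / y2) * (x3 / y3) * (x4 / y4) * (x5 / y5) :: real)"
  have G: "G (F (w, a2, a3, a4, a5, b1, b2, b3, b4, b5)) = w"
    if w: "w \<in> ten_cycles S T" and K: "a2 < M" "a3 < M" "a4 < M" "a5 < M" "b1 < M" "b2 < M" "b3 < M" "b4 < M" "b5 < M"
    for w a2 a3 a4 a5 b1 b2 b3 b4 b5
  proof -
    have nz: "e (s1 w) 0 \<noteq> 0" "e (s2 w) a2 \<noteq> 0" "e (s3 w) a3 \<noteq> 0" "e (s4 w) a4 \<noteq> 0" "e (s5 w) a5 \<noteq> 0"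
      "d (m1 w) b1 \<noteq> 0" "d (m2 w) b2 \<noteq> 0" "d (m3 w) b3 \<noteq> 0" "d (m4 w) b4 \<noteq> 0" "d (m5 w) b5 \<noteq> 0"
      using mem[OF w] K M e0 d0 by auto
    have reduce: "(x1 * y1 * p) / (x2 * y1 * q) = (x1 / x2) * (p / q)" if "y1 \<noteq> 0" for x1 x2 y1 p q :: real
      using that by simp
    have "G (F (w, a2, a3, a4, a5, b1, b2, b3, b4, b5)) =
       (e (s1 w) 0 / e (s2 w) a2) * ((m1 w - s1 w) / (m1 w - s2 w))
       * ((e (s2 w) a2 / e (s3 w) a3) * ((m2 w - s2 w) / (m2 w - s3 w)))
       * ((e (s3 w) a3 / e (s4 w) a4) * ((m3 w - s3 w) / (m3 w - s4 w)))
       * ((e (s4 w) a4 / e (s5 w) a5) * ((m4 w - s4 w) / (m4 w - s5 w)))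
       * ((e (s5 w) a5 / e (s1 w) 0) * ((m5 w - s5 w) / (m5 w - s1 w)))"
      unfolding G_def F_def by (simp only: prod.case reduce nz not_False_eq_True)
    also have "\<dots> = (m1 w - s1 w) / (m1 w - s2 w) * ((m2 w - s2 w) / (m2 w - s3 w)) * ((m3 w - s3 w) / (m3 w - s4 w))
        * ((m4 w - s4 w) / (m4 w - s5 w)) * ((m5 w - s5 w) / (m5 w - s1 w))"
    proof -
      have "(x1 / x2) * A * ((x2 / x3) * B) * ((x3 / x4) * C) * ((x4 / x5) * D) * ((x5 / x1) * E) = A * B * C * D * E"
        if "x1 \<noteq> 0" "x2 \<noteq> 0" "x3 \<noteq> 0" "x4 \<noteq> 0" "x5 \<noteq> 0" for x1 x2 x3 x4 x5 A B C D E :: real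
        using that by simp
      then show ?thesis using nz by blast
    qed
    also have "\<dots> = w" using w_eq[OF w] by simp
    finally show ?thesis .
  qed
  have "inj_on F W"
  proof (rule inj_onI)
    fix z z' assume z: "z \<in> W" "z' \<in> W" and eq: "F z = F z'"
    obtain w a2 a3 a4 a5 b1 b2 b3 b4 b5 where z_eq: "z = (w, a2, a3, a4, a5, b1, b2, b3, b4, b5)"
      by (metis prod.collapse)
    obtain w' a2' a3' a4' a5' b1' b2' b3' b4' b5' where z'_eq: "z' = (w', a2', a3', a4', a5', b1', b2', b3', b4', b5')"
      by (metis prod.collapse)
    have b: "w \<in> ten_cycles S T" "a2 < M" "a3 < M" "a4 < M" "a5 < M" "b1 < M" "b2 < M" "b3 < M" "b4 < M" "b5 < M"
      using z(1) by (auto simp: W_def K_def z_eq)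
    have b': "w' \<in> ten_cycles S T" "a2' < M" "a3' < M" "a4' < M" "a5' < M" "b1' < M" "b2' < M" "b3' < M" "b4' < M" "b5' < M"
      using z(2) by (auto simp: W_def K_def z'_eq)
    have w': "w' = w" using arg_cong[OF eq, of G] G[OF b] G[OF b'] by (simp add: z_eq z'_eq)
    \<comment> \<open>With the walks equal, each entry after the first shares a scalar with its
      predecessor, so the indices are identified one after another, starting from the fixed scalar
      at \<open>s1\<close>.\<close>
    note c = eq[unfolded z_eq z'_eq w' F_def prod.case prod.inject]
    note m = mem[OF b(1)]
    have b1: "b1 = b1'"
      by (rule peel_d[OF c[THEN conjunct1]])
        (simp_all add: m b b' e0 d0 M)
    have a2: "a2 = a2'"
      by (rule peel_e[OF c[THEN conjunct2, THEN conjunct1, unfolded b1]])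
        (simp_all add: m b b' e0 d0 M)
    have b2: "b2 = b2'"
      by (rule peel_d[OF c[THEN conjunct2, THEN conjunct2, THEN conjunct1, unfolded a2]])
        (simp_all add: m b b' e0 d0 M)
    have a3: "a3 = a3'"
      by (rule peel_e[OF c[THEN conjunct2, THEN conjunct2, THEN conjunct2, THEN conjunct1, unfolded b2]])
        (simp_all add: m b b' e0 d0 M)
    have b3: "b3 = b3'"
      by (rule peel_d[OF c[THEN conjunct2, THEN conjunct2, THEN conjunct2, THEN conjunct2, THEN conjunct1, unfolded a3]])
        (simp_all add: m b b' e0 d0 M)
    have a4: "a4 = a4'"
      by (rule peel_e[OF c[THEN conjunct2, THEN conjunct2, THEN conjunct2, THEN conjunct2, THEN conjunct2, THEN conjunct1, unfolded b3]])
        (simp_all add: m b b' e0 d0 M)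
    have b4: "b4 = b4'"
      by (rule peel_d[OF c[THEN conjunct2, THEN conjunct2, THEN conjunct2, THEN conjunct2, THEN conjunct2, THEN conjunct2, THEN conjunct1, unfolded a4]])
        (simp_all add: m b b' e0 d0 M)
    have a5: "a5 = a5'"
      by (rule peel_e[OF c[THEN conjunct2, THEN conjunct2, THEN conjunct2, THEN conjunct2, THEN conjunct2, THEN conjunct2, THEN conjunct2, THEN conjunct1, unfolded b4]])
        (simp_all add: m b b' e0 d0 M)
    have b5: "b5 = b5'"
      by (rule peel_d[OF c[THEN conjunct2, THEN conjunct2, THEN conjunct2, THEN conjunct2, THEN conjunct2, THEN conjunct2, THEN conjunct2, THEN conjunct2, THEN conjunct1, unfolded a5]])
        (simp_all add: m b b' e0 d0 M)
    show "z = z'" by (simp add: z_eq z'_eq w' a2 a3 a4 a5 b1 b2 b3 b4 b5)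
  qed
  moreover have "F ` W \<subseteq> \<Lambda> \<times> \<Lambda> \<times> \<Lambda> \<times> \<Lambda> \<times> \<Lambda> \<times> \<Lambda> \<times> \<Lambda> \<times> \<Lambda> \<times> \<Lambda> \<times> \<Lambda>"
  proof (rule image_subsetI)
    fix z assume z: "z \<in> W"
    obtain w a2 a3 a4 a5 b1 b2 b3 b4 b5 where z_eq: "z = (w, a2, a3, a4, a5, b1, b2, b3, b4, b5)"
      by (metis prod.collapse)
    have b: "w \<in> ten_cycles S T" "a2 < M" "a3 < M" "a4 < M" "a5 < M" "b1 < M" "b2 < M" "b3 < M" "b4 < M" "b5 < M"
      using z by (auto simp: W_def K_def z_eq)
    show "F z \<in> \<Lambda> \<times> \<Lambda> \<times> \<Lambda> \<times> \<Lambda> \<times> \<Lambda> \<times> \<Lambda> \<times> \<Lambda> \<times> \<Lambda> \<times> \<Lambda> \<times> \<Lambda>"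
      unfolding F_def z_eq prod.case mem_Times_iff fst_conv snd_conv
      using mem[OF b(1)] b M by (intro conjI \<Lambda> e(1) d(1)) auto
  qed
  ultimately have "card W \<le> card (\<Lambda> \<times> \<Lambda> \<times> \<Lambda> \<times> \<Lambda> \<times> \<Lambda> \<times> \<Lambda> \<times> \<Lambda> \<times> \<Lambda> \<times> \<Lambda> \<times> \<Lambda>)"
    using fin by (intro card_inj_on_le) auto
  then show ?thesis by (simp add: W_def K_def card_cartesian_product eval_nat_numeral mult_ac)
qed simp

lemma separated_sets_bound:
  fixes X Y :: "real \<Rightarrow> real set"
  assumes "finite \<Lambda>" "finite S" "finite T" and sep: "\<And>s m. s \<in> S \<Longrightarrow> m \<in> T \<Longrightarrow> s < m"
    and X: "\<And>s. s \<in> S \<Longrightarrow> M \<le> card (X s)" "\<And>s. s \<in> S \<Longrightarrow> 0 \<notin> X s"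
    and Y: "\<And>m. m \<in> T \<Longrightarrow> M \<le> card (Y m)" "\<And>m. m \<in> T \<Longrightarrow> 0 \<notin> Y m"
    and \<Lambda>: "\<And>s m x y. s \<in> S \<Longrightarrow> m \<in> T \<Longrightarrow> x \<in> X s \<Longrightarrow> y \<in> Y m \<Longrightarrow> x * y * (m - s) \<in> \<Lambda>"
    and k: "k < card S" "k < card T" "4 \<le> k"
  shows "k ^ 3 * M ^ 9 \<le> 16 * card \<Lambda> ^ 10"
proof -
  have "k ^ 3 * M ^ 9 \<le> 16 * card (ten_cycles S T) * M ^ 9"
    using card_ten_cycles_ge[OF assms(2,3) sep k] by (rule mult_right_mono) auto
  also have "\<dots> = 16 * (card (ten_cycles S T) * M ^ 9)" by simp
  also have "\<dots> \<le> 16 * card \<Lambda> ^ 10"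
    using card_ten_cycles_mult_le[OF assms(1) sep X Y \<Lambda>] by (intro mult_left_mono) auto
  finally show ?thesis .
qed
subsection \<open>Points on rich lines through the origin\<close>

text \<open>Serves to separate slopes from negative reciprocals by one threshold. When the size is
  odd the extra element goes to the upper part, hence the \<open>+ 1\<close> on the lower side
  only.\<close>

lemma median_split:
  fixes A :: "'a::linorder set"
  assumes "finite A" "2 \<le> card A"
  obtains \<tau> where "card A \<le> 2 * card {a \<in> A. a \<le> \<tau>} + 1" "card A \<le> 2 * card {a \<in> A. \<tau> < a}"
proof -
  obtain e where e: "\<And>i j. i < j \<Longrightarrow> j < card A \<Longrightarrow> e i < e j" "\<And>i. i < card A \<Longrightarrow> e i \<in> A"
    using finite_set_strict_enumeration[OF assms(1)] by blast
  define h where "h = card A div 2"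
  have h: "0 < h" "h < card A" "card A \<le> 2 * h + 1" "2 * h \<le> card A" using assms(2) by (auto simp: h_def)
  have "strict_mono_on {..<card A} e" by (auto intro!: strict_mono_onI e(1))
  then have inj: "inj_on e {..<card A}" by (rule strict_mono_on_imp_inj_on)
  have "e ` {..<h} \<subseteq> {a \<in> A. a \<le> e (h - 1)}"
  proof clarify
    fix i assume "i < h"
    then have "e i \<le> e (h - 1)" using e(1)[of i "h - 1"] h by (cases "i = h - 1") (simp_all add: less_imp_le)
    then show "e i \<in> A \<and> e i \<le> e (h - 1)" using e(2) \<open>i < h\<close> h by simp
  qed
  then have "h \<le> card {a \<in> A. a \<le> e (h - 1)}"
    using card_mono[of "{a \<in> A. a \<le> e (h - 1)}" "e ` {..<h}"] assms(1) card_image[OF inj_on_subset[OF inj], of "{..<h}"] h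
    by auto
  moreover have "e ` {h..<card A} \<subseteq> {a \<in> A. e (h - 1) < a}"
    using e h by (auto intro!: e(1))
  then have "card A - h \<le> card {a \<in> A. e (h - 1) < a}"
  proof -
    have "card (e ` {h..<card A}) = card A - h"
      by (subst card_image, rule inj_on_subset[OF inj]) auto
    with \<open>e ` {h..<card A} \<subseteq> _\<close> show ?thesis
      using card_mono[of "{a \<in> A. e (h - 1) < a}" "e ` {h..<card A}"] assms(1) by simp
  qed
  ultimately show ?thesis using h by (intro that[of "e (h - 1)"]) linarith+
qed

text \<open>Coordinates on the line of slope \<open>t\<close> through the origin, without the
  origin: points at \<open>x\<close> and \<open>y\<close> on lines of slopes \<open>s\<close> and
  \<open>t\<close> have dot product \<open>x * y * (1 + s * t)\<close>. The vertical line is counted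
  separately.\<close>

definition abscissas :: "(real \<times> real) set \<Rightarrow> real \<Rightarrow> real set" where
  "abscissas P t = {x. x \<noteq> 0 \<and> (x, x * t) \<in> P}"

definition pair_dots :: "(real \<times> real) set \<Rightarrow> real set" where
  "pair_dots P = (\<lambda>(p, q). fst p * fst q + snd p * snd q) ` (P \<times> P)"

lemma finite_pair_dots: "finite P \<Longrightarrow> finite (pair_dots P)"
  by (simp add: pair_dots_def)

lemma pair_dotsI: "p \<in> P \<Longrightarrow> q \<in> P \<Longrightarrow> fst p * fst q + snd p * snd q \<in> pair_dots P"
  unfolding pair_dots_def by (rule image_eqI[of _ _ "(p, q)"]) auto

lemma finite_abscissas: "finite P \<Longrightarrow> finite (abscissas P t)"
  by (rule finite_subset[of _ "fst ` P"]) (force simp: abscissas_def)+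

lemma abscissas_dot:
  "x \<in> abscissas P s \<Longrightarrow> y \<in> abscissas P t \<Longrightarrow> x * y * (1 + s * t) \<in> pair_dots P"
  using pair_dotsI[of "(x, x * s)" P "(y, y * t)"] by (simp add: abscissas_def algebra_simps)

text \<open>Dot products with one fixed point of the line are distinct along it, as
  \<open>1 + t * t\<close> is nonzero.\<close>

lemma card_abscissas_le:
  assumes "finite P"
  shows "card (abscissas P t) \<le> card (pair_dots P)"
proof (cases "abscissas P t = {}")
  case False
  then obtain x where x: "x \<in> abscissas P t" by auto
  have "1 + t * t \<noteq> 0" by (smt (verit) zero_le_square)
  then have "inj_on (\<lambda>y. x * y * (1 + t * t)) (abscissas P t)"
    using x by (intro inj_onI) (simp add: abscissas_def)
  moreover have "(\<lambda>y. x * y * (1 + t * t)) ` abscissas P t \<subseteq> pair_dots P"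
    using x abscissas_dot by blast
  ultimately show ?thesis using finite_pair_dots[OF assms] card_inj_on_le by blast
qed simp

definition rich_slopes :: "(real \<times> real) set \<Rightarrow> nat \<Rightarrow> real set" where
  "rich_slopes P M = {t. M \<le> card (abscissas P t)}"

lemma finite_rich_slopes:
  assumes "finite P" "0 < M"
  shows "finite (rich_slopes P M)"
proof -
  have "rich_slopes P M \<subseteq> (\<lambda>p. snd p / fst p) ` P"
  proof
    fix t assume "t \<in> rich_slopes P M"
    then have "abscissas P t \<noteq> {}" using assms(2) by (auto simp: rich_slopes_def)
    then obtain x where "x \<noteq> 0" "(x, x * t) \<in> P" by (auto simp: abscissas_def)
    then show "t \<in> (\<lambda>p. snd p / fst p) ` P" by (intro image_eqI[of _ _ "(x, x * t)"]) auto
  qed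
  then show ?thesis using assms(1) finite_subset by blast
qed

text \<open>Writing one slope as \<open>- 1 / m\<close> and dividing its abscissas by
  \<open>m\<close> turns the dot product into \<open>x * y * (m - s)\<close>, the form required by
  \<open>separated_sets_bound\<close>. A median of the slopes provides large sets of
  \<open>s\<close> and \<open>m\<close> on opposite sides of it.\<close>

lemma card_rich_slopes_le:
  assumes P: "finite P" "P \<noteq> {}" and M: "0 < M"
  shows "card (rich_slopes P M) ^ 3 * M ^ 9 \<le> 8000 * card (pair_dots P) ^ 10"
proof -
  define n L where "n = card (rich_slopes P M)" and "L = card (pair_dots P)"
  have "pair_dots P \<noteq> {}" using P by (auto simp: pair_dots_def)
  then have "0 < L" using finite_pair_dots[OF P(1)] by (simp add: L_def card_gt_0_iff)
  \<comment> \<open>Up to 20 slopes, \<open>M \<le> L\<close> is enough and gives the constant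
    \<open>8000 = 20 ^ 3\<close>; beyond 20 there is room for the rounding losses.\<close>
  consider "n = 0" | "0 < n" "n \<le> 20" | "20 < n" by linarith
  then have "n ^ 3 * M ^ 9 \<le> 8000 * L ^ 10"
  proof cases
    case 2
    then obtain t where "t \<in> rich_slopes P M"
      unfolding n_def by (metis card.empty equals0I less_numeral_extra(3))
    then have "M \<le> L" using card_abscissas_le[OF P(1), of t] by (simp add: rich_slopes_def L_def)
    have "n ^ 3 * M ^ 9 \<le> 20 ^ 3 * L ^ 9" using 2 \<open>M \<le> L\<close> by (intro mult_mono power_mono) auto
    also have "\<dots> \<le> 8000 * L ^ 10" using \<open>0 < L\<close> by (simp add: power_increasing)
    finally show ?thesis .
  next
    case 3
    \<comment> \<open>Slope 0 has no negative reciprocal.\<close>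
    define T where "T = rich_slopes P M - {0}"
    define U where "U = (\<lambda>t. - 1 / t) ` T"
    have finT: "finite T" "finite U" using finite_rich_slopes[OF P(1) M] by (auto simp: T_def U_def)
    have cardT: "n \<le> card T + 1"
      using diff_card_le_card_Diff[of "{0}" "rich_slopes P M"] by (simp add: T_def n_def)
    have cardU: "card U = card T" unfolding U_def by (rule card_image) (auto simp: inj_on_def T_def)
    define Y where "Y m = (\<lambda>y. y / m) ` abscissas P (- 1 / m)" for m
    have U: "m \<noteq> 0" "- 1 / m \<in> rich_slopes P M" if "m \<in> U" for m
      using that by (auto simp: U_def T_def)
    have X: "M \<le> card (abscissas P s)" if "s \<in> T" for s
      using that by (auto simp: T_def rich_slopes_def)
    have Y: "M \<le> card (Y m)" if "m \<in> U" for m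
    proof -
      have "card (Y m) = card (abscissas P (- 1 / m))"
        unfolding Y_def by (rule card_image) (use U[OF that] in \<open>auto simp: inj_on_def\<close>)
      then show ?thesis using U[OF that] by (simp add: rich_slopes_def)
    qed
    have X0: "0 \<notin> abscissas P s" for s by (simp add: abscissas_def)
    have Y0: "0 \<notin> Y m" if "m \<in> U" for m using U[OF that] by (auto simp: Y_def abscissas_def)
    have dot: "x * y * (m - s) \<in> pair_dots P" if mxy: "m \<in> U" "x \<in> abscissas P s" "y \<in> Y m" for m s x y
    proof -
      obtain y' where y': "y' \<in> abscissas P (- 1 / m)" "y = y' / m" using mxy(3) by (auto simp: Y_def)
      have eq: "x * y * (m - s) = x * y' * (1 + s * (- 1 / m))"
        using U[OF mxy(1)] by (simp add: y'(2) field_simps)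
      show ?thesis unfolding eq by (rule abscissas_dot[OF mxy(2) y'(1)])
    qed
    have "2 \<le> card T" using cardT 3 by linarith
    then obtain \<tau> where \<tau>: "card T \<le> 2 * card {a \<in> T. a \<le> \<tau>} + 1" "card T \<le> 2 * card {a \<in> T. \<tau> < a}"
      using median_split[OF finT(1)] by blast
    have "U = {m \<in> U. m \<le> \<tau>} \<union> {m \<in> U. \<tau> < m}" by auto
    then have "card U \<le> card {m \<in> U. m \<le> \<tau>} + card {m \<in> U. \<tau> < m}" by (metis card_Un_le)
    then consider "card T \<le> 2 * card {m \<in> U. m \<le> \<tau>}" | "card T \<le> 2 * card {m \<in> U. \<tau> < m}"
      using cardU by linarith
    \<comment> \<open>The lower part may fall short of \<open>card T / 2\<close>, and
      \<open>separated_sets_bound\<close> needs sets strictly larger than its parameter: hence the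
      two subtractions.\<close>
    then have "((card T - 1) div 2 - 1) ^ 3 * M ^ 9 \<le> 16 * L ^ 10"
    proof cases
      case 1
      \<comment> \<open>Here the \<open>m\<close> lie below the slopes, so the two families exchange
        roles and the products change sign.\<close>
      have "((card T - 1) div 2 - 1) ^ 3 * M ^ 9 \<le> 16 * card (uminus ` pair_dots P) ^ 10"
      proof (rule separated_sets_bound[of _ "{m \<in> U. m \<le> \<tau>}" "{s \<in> T. \<tau> < s}" M Y "abscissas P"])
        show "x * y * (s - m) \<in> uminus ` pair_dots P"
          if "m \<in> {m \<in> U. m \<le> \<tau>}" "s \<in> {s \<in> T. \<tau> < s}" "x \<in> Y m" "y \<in> abscissas P s" for m s x y
          using dot[of m y s x] that by (intro image_eqI[of _ _ "y * x * (m - s)"]) (auto simp: algebra_simps)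
      qed (use 1 3 \<tau> cardT finT finite_pair_dots[OF P(1)] X Y X0 Y0 in \<open>auto simp: less_le_trans\<close>)
      then show ?thesis by (simp add: L_def card_image)
    next
      case 2
      show ?thesis unfolding L_def
      proof (rule separated_sets_bound[of _ "{s \<in> T. s \<le> \<tau>}" "{m \<in> U. \<tau> < m}" M "abscissas P" Y])
      qed (use 2 3 \<tau> cardT finT finite_pair_dots[OF P(1)] X Y X0 Y0 dot in auto)
    qed
    moreover have "n \<le> 4 * ((card T - 1) div 2 - 1)" using 3 cardT by linarith
    then have "n ^ 3 \<le> (4 * ((card T - 1) div 2 - 1)) ^ 3" by (rule power_mono) simp
    then have "n ^ 3 * M ^ 9 \<le> 64 * (((card T - 1) div 2 - 1) ^ 3 * M ^ 9)"
      by (simp add: power_mult_distrib flip: mult.assoc)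
    ultimately show ?thesis by linarith
  qed simp
  then show ?thesis by (simp add: n_def L_def)
qed

text \<open>\<open>q\<close> counts the points off the vertical axis and off the rich lines. The
  axis with the origin, and each rich line without it, carry at most \<open>L\<close> points. If the
  \<open>q\<close> points have \<open>k\<close> slopes, then \<open>q \<le> k * M\<close>, and for
  \<open>4 * L \<le> q\<close> also \<open>(k - 1) * q \<le> 32 * L^2\<close> by
  \<open>few_projections\<close>.\<close>

lemma card_points_le:
  fixes P :: "(real \<times> real) set" and M :: nat
  defines "L \<equiv> card (pair_dots P)"
  assumes P: "finite P" "P \<noteq> {}" and M: "0 < M"
  obtains q :: real where "0 \<le> q" "card P \<le> L + q + card (rich_slopes P M) * real L"
    "q \<le> 4 * real L \<or> q\<^sup>2 \<le> M * (32 * (real L)\<^sup>2 + q)"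
proof -
  define slope where "slope p = snd p / fst p" for p :: "real \<times> real"
  define V where "V = {p \<in> P. fst p = 0}"
  define R where "R = {p \<in> P. fst p \<noteq> 0 \<and> slope p \<in> rich_slopes P M}"
  define Q where "Q = {p \<in> P. fst p \<noteq> 0 \<and> slope p \<notin> rich_slopes P M}"
  have "pair_dots P \<noteq> {}" using P by (auto simp: pair_dots_def)
  then have L: "0 < L" using finite_pair_dots[OF P(1)] by (simp add: L_def card_gt_0_iff)
  have finQ: "finite Q" using P by (simp add: Q_def)
  have fib: "{p \<in> P. fst p \<noteq> 0 \<and> slope p = t} = (\<lambda>x. (x, x * t)) ` abscissas P t" for t
    by (force simp: abscissas_def slope_def image_iff)
  have card_fib: "card {p \<in> P. fst p \<noteq> 0 \<and> slope p = t} = card (abscissas P t)" for t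
    unfolding fib by (rule card_image) (simp add: inj_on_def)
  have "card V \<le> L"
  proof (cases "\<exists>p\<in>V. snd p \<noteq> 0")
    case True
    then obtain p where p: "p \<in> P" "fst p = 0" "snd p \<noteq> 0" by (auto simp: V_def)
    have "inj_on (\<lambda>q. fst p * fst q + snd p * snd q) V"
      using p by (auto simp: inj_on_def V_def prod_eq_iff)
    moreover have "(\<lambda>q. fst p * fst q + snd p * snd q) ` V \<subseteq> pair_dots P"
      by (intro image_subsetI pair_dotsI) (use p in \<open>auto simp: V_def\<close>)
    ultimately show ?thesis unfolding L_def using finite_pair_dots[OF P(1)] card_inj_on_le by blast
  next
    case False
    then have "V \<subseteq> {(0, 0)}" by (auto simp: V_def)
    then have "card V \<le> 1" using card_mono[of "{(0::real, 0::real)}" V] by simp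
    with L show ?thesis by simp
  qed
  moreover have "card R \<le> card (rich_slopes P M) * L"
  proof -
    have "R = (\<Union>t\<in>rich_slopes P M. {p \<in> P. fst p \<noteq> 0 \<and> slope p = t})" by (auto simp: R_def)
    then have "card R \<le> (\<Sum>t\<in>rich_slopes P M. card {p \<in> P. fst p \<noteq> 0 \<and> slope p = t})"
      using card_UN_le[OF finite_rich_slopes[OF P(1) M]] by simp
    also have "\<dots> \<le> (\<Sum>t\<in>rich_slopes P M. L)"
      unfolding card_fib L_def using card_abscissas_le[OF P(1)] by (intro sum_mono)
    finally show ?thesis by simp
  qed
  moreover have "card P \<le> card V + card Q + card R"
  proof -
    have "P = V \<union> Q \<union> R" by (auto simp: V_def Q_def R_def)
    then show ?thesis by (metis card_Un_le add_le_mono1 le_trans)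
  qed
  ultimately have "card P \<le> L + card Q + card (rich_slopes P M) * L" by linarith
  moreover have "real (card Q) \<le> 4 * real L \<or> (real (card Q))\<^sup>2 \<le> M * (32 * (real L)\<^sup>2 + card Q)"
  proof (cases "4 * L \<le> card Q")
    case True
    define T where "T = slope ` Q"
    have card_proj: "card ((\<lambda>q. fst q + snd q * t) ` Q) \<le> L" if t: "t \<in> T" for t
    proof -
      obtain p where p: "p \<in> P" "fst p \<noteq> 0" "t = slope p" using t by (auto simp: T_def Q_def)
      \<comment> \<open>Up to the nonzero factor \<open>fst p\<close>, the dot product with
        \<open>p\<close> is the projection with parameter \<open>slope p\<close>.\<close>
      have eq: "fst p * (fst q + snd q * t) = fst p * fst q + snd p * snd q" for q
        using p by (simp add: slope_def field_simps)
      have "inj_on (\<lambda>v. fst p * v) ((\<lambda>q. fst q + snd q * t) ` Q)"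
        using p by (auto simp: inj_on_def)
      moreover have "(\<lambda>v. fst p * v) ` (\<lambda>q. fst q + snd q * t) ` Q \<subseteq> pair_dots P"
        using eq pair_dotsI[OF p(1)] by (auto simp: Q_def)
      ultimately show ?thesis unfolding L_def using finite_pair_dots[OF P(1)] card_inj_on_le by blast
    qed
    have "(real (card T) - 1) * card Q \<le> 32 * (real L)\<^sup>2"
      by (rule few_projections) (use finQ card_proj True L in \<open>auto simp: T_def\<close>)
    moreover have "card Q \<le> card T * M"
    proof -
      have "Q \<subseteq> (\<Union>t\<in>T. {p \<in> P. fst p \<noteq> 0 \<and> slope p = t})" by (auto simp: T_def Q_def)
      then have "card Q \<le> card (\<Union>t\<in>T. {p \<in> P. fst p \<noteq> 0 \<and> slope p = t})"
        using finQ P by (intro card_mono) (auto simp: T_def)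
      also have "\<dots> \<le> (\<Sum>t\<in>T. card {p \<in> P. fst p \<noteq> 0 \<and> slope p = t})"
        using finQ by (intro card_UN_le) (simp add: T_def)
      also have "\<dots> \<le> (\<Sum>t\<in>T. M)"
        unfolding card_fib by (intro sum_mono) (auto simp: T_def Q_def rich_slopes_def)
      finally show ?thesis by simp
    qed
    then have "real (card Q) \<le> real (card T) * M" by (simp flip: of_nat_mult)
    then have "(real (card Q))\<^sup>2 \<le> real (card T) * M * card Q"
      by (simp add: power2_eq_square mult_right_mono)
    moreover have "real (card T) * M * card Q = M * ((real (card T) - 1) * card Q + card Q)"
      by (simp add: algebra_simps)
    ultimately show ?thesis
      by (smt (verit) mult_left_mono of_nat_0_le_iff)
  qed simp
  ultimately show ?thesis
    by (intro that[of "real (card Q)"]) (simp_all flip: of_nat_add of_nat_mult)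
qed

section \<open>Choice of the threshold and the final exponent\<close>

lemma card_le_card_pair_dots_powr:
  assumes P: "finite P" "P \<noteq> {}"
  shows "real (card P) \<le> 31 * real (card (pair_dots P)) powr (31 / 21)"
proof -
  define l where "l = real (card (pair_dots P))"
  have "pair_dots P \<noteq> {}" using P by (auto simp: pair_dots_def)
  then have "0 < card (pair_dots P)" using finite_pair_dots[OF P(1)] by (simp add: card_gt_0_iff)
  then have l: "1 \<le> l" by (simp add: l_def)
  \<comment> \<open>The exponent 20/21 balances the poor points, about \<open>l * M^(1/2)\<close>,
    against the rich ones, about \<open>l * (l^10 / M^9)^(1/3)\<close>: both become
    \<open>r\<close>.\<close>
  define v where "v = l powr (20 / 21)"
  define r where "r = l powr (31 / 21)"
  define M where "M = nat \<lceil>v\<rceil>"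
  have v: "1 \<le> v" using l by (simp add: v_def ge_one_powr_ge_zero)
  \<comment> \<open>Rounding up at most doubles \<open>v\<close>, because
    \<open>1 \<le> v\<close>.\<close>
  then have M: "0 < M" "v \<le> real M" "real M \<le> 2 * v" by (auto simp: M_def) linarith+
  have "l \<le> r" "v \<le> r" "1 \<le> r"
    using l powr_mono[of 1 "31/21" l] powr_mono[of "20/21" "31/21" l]
    by (auto simp: r_def v_def ge_one_powr_ge_zero)
  have vl: "v * l\<^sup>2 = r\<^sup>2"
    using l by (simp add: v_def r_def powr_powr powr_add[symmetric] flip: powr_numeral)
  obtain q where q: "0 \<le> q" "card P \<le> l + q + card (rich_slopes P M) * l"
      "q \<le> 4 * l \<or> q\<^sup>2 \<le> M * (32 * l\<^sup>2 + q)"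
    using card_points_le[OF P M(1)] unfolding l_def by metis
  \<comment> \<open>The quadratic alternative gives \<open>q^2 \<le> 64 * r^2 + 2 * r * q\<close>,
    which fails for \<open>q > 10 * r\<close>.\<close>
  have "q \<le> 10 * r"
    using q(3)
  proof
    assume *: "q\<^sup>2 \<le> M * (32 * l\<^sup>2 + q)"
    show ?thesis
    proof (rule ccontr)
      assume "\<not> q \<le> 10 * r"
      then have qr: "10 * r < q" by simp
      have "q\<^sup>2 \<le> 2 * v * (32 * l\<^sup>2 + q)"
        using * M(3) q(1) by (smt (verit) mult_right_mono zero_le_power2)
      also have "\<dots> = 64 * r\<^sup>2 + 2 * (v * q)" by (simp add: algebra_simps flip: vl)
      also have "\<dots> \<le> 64 * r\<^sup>2 + 2 * (r * q)" using \<open>v \<le> r\<close> q(1) by (simp add: mult_right_mono)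
      also have "\<dots> < q\<^sup>2"
      proof -
        have "10 * (r * r) < r * q" "10 * (r * q) < q * q"
          using mult_strict_left_mono[OF qr, of r] mult_strict_right_mono[OF qr, of q] qr \<open>1 \<le> r\<close>
          by (simp_all add: mult_ac)
        moreover have "0 < r * r" using \<open>1 \<le> r\<close> by simp
        ultimately show ?thesis unfolding power2_eq_square by linarith
      qed
      finally show False by simp
    qed
  qed (use \<open>l \<le> r\<close> \<open>1 \<le> r\<close> in linarith)
  moreover have "card (rich_slopes P M) * l \<le> 20 * r"
  proof -
    let ?n = "real (card (rich_slopes P M))"
    have "real (card (rich_slopes P M) ^ 3 * M ^ 9) \<le> real (8000 * card (pair_dots P) ^ 10)"
      using card_rich_slopes_le[OF P M(1)] by (rule of_nat_mono)
    then have "?n ^ 3 * real M ^ 9 \<le> 8000 * l ^ 10" by (simp add: l_def)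
    moreover have "?n ^ 3 * v ^ 9 \<le> ?n ^ 3 * real M ^ 9"
      using M v by (intro mult_left_mono power_mono) auto
    ultimately have "?n ^ 3 * v ^ 9 \<le> 8000 * l ^ 10" by linarith
    \<comment> \<open>The factor \<open>l ^ 3\<close> turns the bound on \<open>?n\<close> into one
      on \<open>?n * l\<close>; the exponents match since
      \<open>13 = 9 * 20/21 + 3 * 31/21\<close>.\<close>
    then have "(?n ^ 3 * v ^ 9) * l ^ 3 \<le> 8000 * l ^ 10 * l ^ 3"
      by (rule mult_right_mono) (use l in simp)
    moreover have "l ^ 10 * l ^ 3 = v ^ 9 * r ^ 3"
      using l by (simp add: v_def r_def powr_powr powr_add[symmetric] flip: powr_numeral)
    ultimately have "v ^ 9 * (?n * l) ^ 3 \<le> v ^ 9 * (20 * r) ^ 3"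
      by (simp add: power_mult_distrib mult_ac)
    then have "(?n * l) ^ 3 \<le> (20 * r) ^ 3" using v by (simp only: mult_le_cancel_left_pos zero_less_power)
    then show ?thesis by (rule power_le_imp_le_base[of _ 2, simplified]) (use \<open>1 \<le> r\<close> in auto)
  qed
  ultimately show ?thesis using q(2) \<open>l \<le> r\<close> unfolding r_def l_def by linarith
qed

theorem theorem1p1:
  shows "(\<exists>c::real. c > 0 \<and>
           (\<forall>P::(real^2) set. finite P \<and> card P \<ge> 2 \<longrightarrow>
              real (card (dot_products P)) \<ge> c * real (card P) powr (199/295)))
         \<and> (199/295 :: real) = 2/3 + 7/885"
proof
  \<comment> \<open>This constant comes from solving \<open>card P \<le> 31 * L powr (31/21)\<close>
    for \<open>L\<close>.\<close>
  define c :: real where "c = (1 / 31) powr (21 / 31)"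
  have "c * real (card P) powr (199/295) \<le> real (card (dot_products P))"
    if P: "finite P" "2 \<le> card P" for P :: "(real^2) set"
  proof -
    define h where "h p = (p $ 1, p $ 2)" for p :: "real^2"
    have inj: "inj_on h P" by (auto simp: inj_on_def h_def vec_eq_iff forall_2)
    have dots: "dot_products P = pair_dots (h ` P)"
      by (force simp: dot_products_def pair_dots_def h_def inner_vec_def sum_2)
    define L where "L = real (card (dot_products P))"
    have "real (card P) \<le> 31 * L powr (31 / 21)"
    proof -
      have "P \<noteq> {}" using P by auto
      then show ?thesis
        using card_le_card_pair_dots_powr[of "h ` P"] P by (simp add: card_image[OF inj] dots L_def)
    qed
    then have "(real (card P) / 31) powr (21 / 31) \<le> (L powr (31 / 21)) powr (21 / 31)"
      by (intro powr_mono2) auto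
    also have "\<dots> = L" by (simp add: powr_powr L_def)
    finally have "c * real (card P) powr (21 / 31) \<le> L"
      by (simp add: c_def powr_divide)
    \<comment> \<open>The exponent 21/31 is the larger one, as \<open>199 * 31 < 21 * 295\<close>,
      and the base is at least 1.\<close>
    moreover have "real (card P) powr (199 / 295) \<le> real (card P) powr (21 / 31)"
      using P by (intro powr_mono) auto
    then have "c * real (card P) powr (199 / 295) \<le> c * real (card P) powr (21 / 31)"
      by (intro mult_left_mono) (simp_all add: c_def)
    ultimately show ?thesis by (simp add: L_def)
  qed
  moreover have "0 < c" by (simp add: c_def)
  ultimately show "\<exists>c::real. c > 0 \<and>
           (\<forall>P::(real^2) set. finite P \<and> card P \<ge> 2 \<longrightarrow>
              real (card (dot_products P)) \<ge> c * real (card P) powr (199/295))" by blast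
qed simp

end
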